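(* Let $(S,C^{\infty}(S))$ be a differential space. If the differential structure $C^{\infty}(S)$ is continuously reflexive, then $C^{\infty}(S)$ is a differentiable structure on $S$ in the sense of Smith.
   Context: A differential structure on a topological space $S$ is a family $C^{\infty}(S)$ of real valued functions on $S$ such that: (1) the sets $f^{-1}(I)$, with $f\in C^{\infty}(S)$ and $I$ an open interval in $\mathbb{R}$, form a subbasis for the topology of $S$; (2) for every $n\in\mathbb{N}$, $f_1,\dots,f_n\in C^{\infty}(S)$ and $F\in C^{\infty}(\mathbb{R}^n)$, $F(f_1,\dots,f_n)\in C^{\infty}(S)$; (3) if $f:S\to\mathbb{R}$ is such that for every $x\in S$ there are an open neighbourhood $U$ of $x$ and $f_x\in C^{\infty}(S)$ with $f_x|_U=f|_U$, then $f\in C^{\infty}(S)$. The pair $(S,C^{\infty}(S))$ is a differential space. Elements of $C^{\infty}(S)$ are continuous by (1). Put $$\Gamma_0C^{\infty}(S)=\{c\in C^0(\mathbb{R},S)\mid f\circ c\in C^{\infty}(\mathbb{R})\text{ for all }f\in C^{\infty}(S)\},$$ $$\Phi_0\Gamma_0C^{\infty}(S)=\{f\in C^0(S)\mid f\circ c\in C^{\infty}(\mathbb{R})\text{ for all }c\in\Gamma_0C^{\infty}(S)\}.$$ $C^{\infty}(S)$ is continuously reflexive if $\Phi_0\Gamma_0C^{\infty}(S)\subseteq C^{\infty}(S)$. Let $\mathfrak{R}$ be the collection of all subsets $U$ which are open in $\mathbb{R}^n$ for some $n\in\mathbb{Z}_{\ge0}$. For a topological space $S$, a subset $\mathcal{F}\subseteq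 C^0(S)$ and $U\in\mathfrak{R}$, let $\mathcal{F}(U)=\{g\in C^0(U,S)\mid f\circ g\in C^{\infty}(U)\text{ for every }f\in\mathcal{F}\}$. $\mathcal{F}$ is a differentiable structure on $S$ in the sense of Smith if every $f\in C^0(S)$ such that $f\circ g\in C^{\infty}(U)$ for every $U\in\mathfrak{R}$ and every $g\in\mathcal{F}(U)$ belongs to $\mathcal{F}$. *)

theory Defs
  imports "HOL-Analysis.Analysis"
begin

text \<open>
  The space \<open>\<real>\<^sup>n\<close> is \<^const>\<open>Euclidean_space\<close> \<open>n\<close>: the sequences vanishing from index \<open>n\<close> on,
  with the subspace topology of the product topology (for \<open>n = 0\<close> a single point).

  For \<open>U\<close> open in \<open>\<real>\<^sup>n\<close>, \<open>Ck_on n U k f\<close> says that all iterated partial derivatives of \<open>f\<close> of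
  order at most \<open>k\<close> exist and are continuous on \<open>U\<close>. It depends only on the values of \<open>f\<close> on \<open>U\<close>.
\<close>

primrec Ck_on :: "nat \<Rightarrow> (nat \<Rightarrow> real) set \<Rightarrow> nat \<Rightarrow> ((nat \<Rightarrow> real) \<Rightarrow> real) \<Rightarrow> bool" where
  "Ck_on n U 0 f \<longleftrightarrow> continuous_map (subtopology (Euclidean_space n) U) euclideanreal f"
| "Ck_on n U (Suc k) f \<longleftrightarrow>
     continuous_map (subtopology (Euclidean_space n) U) euclideanreal f \<and>
     (\<forall>i<n. \<exists>g. (\<forall>x\<in>U. ((\<lambda>t. f (x(i := t))) has_real_derivative g x) (at (x i))) \<and>
               Ck_on n U k g)"

definition smooth_on :: "nat \<Rightarrow> (nat \<Rightarrow> real) set \<Rightarrow> ((nat \<Rightarrow> real) \<Rightarrow> real) \<Rightarrow> bool" where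
  "smooth_on n U f \<longleftrightarrow> (\<forall>k. Ck_on n U k f)"

definition smooth_real :: "(real \<Rightarrow> real) \<Rightarrow> bool" where
  "smooth_real f \<longleftrightarrow> (\<forall>k. (deriv ^^ k) f differentiable_on UNIV)"

text \<open>
  A real function on a space \<open>S\<close> is represented by the HOL function that is \<^const>\<open>undefined\<close>
  outside \<open>topspace S\<close>, so that equality of HOL functions is equality of functions on \<open>S\<close>.
\<close>

definition C0 :: "'a topology \<Rightarrow> ('a \<Rightarrow> real) set" where
  "C0 S = {f \<in> extensional (topspace S). continuous_map S euclideanreal f}"

text \<open>
  In \<open>subbasis\<close> the empty intersection is \<open>topspace S\<close>. In \<open>smooth_closed\<close>, \<open>\<nat>\<close> is read as the
  positive integers; allowing also \<open>n = 0\<close> would only add that constants belong to \<open>C\<close>, which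
  follows from the case \<open>n = 1\<close> as soon as \<open>C\<close> is nonempty.
\<close>

locale differential_space =
  fixes S :: "'a topology" and C :: "('a \<Rightarrow> real) set"
  assumes functions_on: "C \<subseteq> extensional (topspace S)"
    and subbasis:
      "openin S =
         (arbitrary union_of
           (finite intersection_of
             (\<lambda>V. \<exists>f\<in>C. \<exists>I. open I \<and> is_interval I \<and> V = {x \<in> topspace S. f x \<in> I})
            relative_to topspace S))"
    and smooth_closed:
      "\<And>n fs F. \<lbrakk>1 \<le> n; \<forall>i<n. fs i \<in> C; smooth_on n (topspace (Euclidean_space n)) F\<rbrakk>
        \<Longrightarrow> (\<lambda>x\<in>topspace S. F (\<lambda>i. if i < n then fs i x else 0)) \<in> C"
    and locality:
      "\<And>f. \<lbrakk>f \<in> extensional (topspace S);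
             \<forall>x\<in>topspace S. \<exists>U h. openin S U \<and> x \<in> U \<and> h \<in> C \<and> (\<forall>y\<in>U. h y = f y)\<rbrakk>
        \<Longrightarrow> f \<in> C"

definition Gamma0 :: "'a topology \<Rightarrow> ('a \<Rightarrow> real) set \<Rightarrow> (real \<Rightarrow> 'a) set" where
  "Gamma0 S C = {c. continuous_map euclideanreal S c \<and> (\<forall>f\<in>C. smooth_real (f \<circ> c))}"

definition Phi0 :: "'a topology \<Rightarrow> (real \<Rightarrow> 'a) set \<Rightarrow> ('a \<Rightarrow> real) set" where
  "Phi0 S G = {f \<in> C0 S. \<forall>c\<in>G. smooth_real (f \<circ> c)}"

definition continuously_reflexive :: "'a topology \<Rightarrow> ('a \<Rightarrow> real) set \<Rightarrow> bool" where
  "continuously_reflexive S C \<longleftrightarrow> Phi0 S (Gamma0 S C) \<subseteq> C"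

text \<open>
  \<open>plots S F n U\<close> is \<open>F(U)\<close> for \<open>U\<close> open in \<open>\<real>\<^sup>n\<close>. Its elements are not normalised outside \<open>U\<close>;
  the defining conditions do not depend on the values there.
\<close>

definition plots ::
    "'a topology \<Rightarrow> ('a \<Rightarrow> real) set \<Rightarrow> nat \<Rightarrow> (nat \<Rightarrow> real) set \<Rightarrow> ((nat \<Rightarrow> real) \<Rightarrow> 'a) set" where
  "plots S F n U =
     {g. continuous_map (subtopology (Euclidean_space n) U) S g \<and> (\<forall>f\<in>F. smooth_on n U (f \<circ> g))}"

definition smith_differentiable_structure :: "'a topology \<Rightarrow> ('a \<Rightarrow> real) set \<Rightarrow> bool" where
  "smith_differentiable_structure S F \<longleftrightarrow>
     F \<subseteq> C0 S \<and>
     (\<forall>f\<in>C0 S.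
        (\<forall>n U. openin (Euclidean_space n) U \<longrightarrow> (\<forall>g\<in>plots S F n U. smooth_on n U (f \<circ> g)))
        \<longrightarrow> f \<in> F)"

end

theory Submission
  imports Defs
begin

text \<open>
  A curve \<open>c\<close> in \<open>S\<close> is the same thing as the map \<open>x \<mapsto> c (x\<^sub>0)\<close> on \<open>\<real>\<^sup>1\<close>, so the curves in
  \<open>\<Gamma>\<^sub>0 C\<close> become plots with domain \<open>\<real>\<^sup>1\<close>. A continuous function that is smooth along all
  plots is therefore smooth along all curves in \<open>\<Gamma>\<^sub>0 C\<close>, which means that it lies in
  \<open>\<Phi>\<^sub>0 \<Gamma>\<^sub>0 C\<close>; continuous reflexivity then puts it into \<open>C\<close>.

  The work lies in matching the two notions of smoothness on the line, iterated derivatives for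
  functions on \<open>\<real>\<close> and iterated continuous partial derivatives for functions on \<open>\<real>\<^sup>1\<close>
  (\<open>smooth_on_line_if_smooth_real\<close>, \<open>smooth_real_if_smooth_on_line\<close>), and in reading off the
  continuity of the elements of \<open>C\<close> from the subbasis
  (\<open>differential_space.continuous_map_structure_function\<close>).
\<close>

lemma smooth_real_deriv: "smooth_real h \<Longrightarrow> smooth_real (deriv h)"
  unfolding smooth_real_def by (metis comp_apply funpow_Suc_right)

lemma smooth_real_DERIV:
  assumes "smooth_real h"
  shows "(h has_real_derivative deriv h t) (at t)"
proof -
  have "(deriv ^^ 0) h differentiable_on UNIV"
    using assms unfolding smooth_real_def by blast
  then have "h differentiable (at t)"
    by (simp add: differentiable_on_def)
  then show ?thesis
    by (metis DERIV_imp_deriv real_differentiable_def)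
qed

lemma continuous_map_comp_coordinate:
  assumes "continuous_map euclideanreal X c"
  shows "continuous_map (Euclidean_space n) X (\<lambda>x. c (x i))"
proof -
  have "continuous_map (Euclidean_space n) euclideanreal (\<lambda>x. x i)"
    unfolding Euclidean_space_def
    by (intro continuous_map_from_subtopology continuous_map_product_projection) simp
  from continuous_map_compose[OF this assms] show ?thesis
    by (simp add: o_def)
qed

text \<open>
  The partial derivative of \<open>x \<mapsto> h (x\<^sub>0)\<close> is \<open>x \<mapsto> h' (x\<^sub>0)\<close>, a function of the same form, and all
  these functions are continuous because \<open>h\<close> and its derivatives are differentiable.
\<close>

lemma smooth_on_line_if_smooth_real:
  assumes "smooth_real h"
  shows "smooth_on 1 (topspace (Euclidean_space 1)) (\<lambda>x. h (x 0))"
proof -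
  have "Ck_on 1 (topspace (Euclidean_space 1)) k (\<lambda>x. h (x 0))" for k
    using assms
  proof (induction k arbitrary: h)
    case (0 h)
    have "continuous_on UNIV h"
      using smooth_real_DERIV[OF 0] by (meson DERIV_isCont continuous_at_imp_continuous_on)
    then show ?case
      using continuous_map_comp_coordinate[of euclideanreal h 1 0] by simp
  next
    case (Suc k h)
    have "continuous_on UNIV h"
      using smooth_real_DERIV[OF Suc.prems]
      by (meson DERIV_isCont continuous_at_imp_continuous_on)
    then have "continuous_map (Euclidean_space 1) euclideanreal (\<lambda>x. h (x 0))"
      using continuous_map_comp_coordinate[of euclideanreal h 1 0] by simp
    moreover have "Ck_on 1 (topspace (Euclidean_space 1)) k (\<lambda>x. deriv h (x 0))"
      using Suc.IH smooth_real_deriv[OF Suc.prems] by blast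
    ultimately show ?case
      using smooth_real_DERIV[OF Suc.prems]
      by (auto intro!: exI[of _ "\<lambda>x. deriv h (x 0)"])
  qed
  then show ?thesis
    by (simp add: smooth_on_def)
qed

text \<open>
  Composing with the parametrisation \<open>t \<mapsto> (t, 0, 0, \<dots>)\<close> of \<open>\<real>\<^sup>1\<close> turns the partial derivative
  into the ordinary one. Since \<open>Ck_on\<close> bounds the order of differentiation, the induction carries
  one order more than the derivative it reaches: the \<open>k\<close>-th derivative is differentiable for a
  function of class \<open>C\<^sup>k\<^sup>+\<^sup>1\<close>.
\<close>

lemma smooth_real_if_smooth_on_line:
  assumes "smooth_on 1 (topspace (Euclidean_space 1)) f"
  shows "smooth_real (\<lambda>t. f (\<lambda>i. if i = 0 then t else 0))"
proof -
  define e :: "real \<Rightarrow> nat \<Rightarrow> real" where "e t = (\<lambda>i. if i = 0 then t else 0)" for t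
  have e_in: "e t \<in> topspace (Euclidean_space 1)" for t
    by (simp add: e_def topspace_Euclidean_space)
  have e_upd: "(e t)(0 := s) = e s" for s t
    by (auto simp: e_def)
  have e_0: "e t 0 = t" for t
    by (simp add: e_def)
  have "(deriv ^^ k) (\<lambda>t. f (e t)) differentiable_on UNIV"
    if "Ck_on 1 (topspace (Euclidean_space 1)) (Suc k) f" for k f
    using that
  proof (induction k arbitrary: f)
    case (0 f)
    then obtain g where g: "\<forall>x\<in>topspace (Euclidean_space 1).
        ((\<lambda>t. f (x(0 := t))) has_real_derivative g x) (at (x 0))"
      unfolding Ck_on.simps(2) by (metis less_one)
    have "((\<lambda>s. f (e s)) has_real_derivative g (e t)) (at t)" for t
      using bspec[OF g e_in[of t]] by (simp add: e_upd e_0)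
    then show ?case
      by (auto simp: differentiable_on_def real_differentiable_def)
  next
    case (Suc k f)
    then obtain g where g: "\<forall>x\<in>topspace (Euclidean_space 1).
        ((\<lambda>t. f (x(0 := t))) has_real_derivative g x) (at (x 0))"
      and Ck: "Ck_on 1 (topspace (Euclidean_space 1)) (Suc k) g"
      unfolding Ck_on.simps(2)[of _ _ "Suc k"] by (metis less_one)
    have "((\<lambda>s. f (e s)) has_real_derivative g (e t)) (at t)" for t
      using bspec[OF g e_in[of t]] by (simp add: e_upd e_0)
    then have "deriv (\<lambda>s. f (e s)) = (\<lambda>t. g (e t))"
      by (auto intro: DERIV_imp_deriv)
    then show ?case
      using Suc.IH[OF Ck] by (simp add: funpow_Suc_right del: funpow.simps)
  qed
  then show ?thesis
    using assms unfolding smooth_on_def smooth_real_def e_def by blast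
qed

text \<open>
  The preimages of open intervals are members of the subbasis, hence open, and every open subset
  of \<open>\<real>\<close> is a union of open intervals.
\<close>

lemma (in differential_space) continuous_map_structure_function:
  assumes "f \<in> C"
  shows "continuous_map S euclideanreal f"
proof -
  have interval: "openin S {x \<in> topspace S. f x \<in> I}" if "open I" "is_interval I" for I
  proof -
    let ?P = "\<lambda>V. \<exists>f\<in>C. \<exists>I. open I \<and> is_interval I \<and> V = {x \<in> topspace S. f x \<in> I}"
    let ?V = "{x \<in> topspace S. f x \<in> I}"
    have "(finite intersection_of ?P) ?V"
      using that assms by (intro finite_intersection_of_inc) blast
    then have "(finite intersection_of ?P relative_to topspace S) (topspace S \<inter> ?V)"
      by (rule relative_to_inc)
    moreover have "topspace S \<inter> ?V = ?V"
      by blast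
    ultimately have "(finite intersection_of ?P relative_to topspace S) ?V"
      by simp
    then show ?thesis
      unfolding subbasis by (rule arbitrary_union_of_inc)
  qed
  have "openin S {x \<in> topspace S. f x \<in> T}" if "open T" for T
  proof (subst openin_subopen, safe)
    fix x assume "x \<in> topspace S" "f x \<in> T"
    then obtain d where "d > 0" "ball (f x) d \<subseteq> T"
      using \<open>open T\<close> open_contains_ball by blast
    moreover have "openin S {y \<in> topspace S. f y \<in> ball (f x) d}"
      by (intro interval) (auto simp: is_interval_ball_real)
    ultimately show "\<exists>V. openin S V \<and> x \<in> V \<and> V \<subseteq> {x \<in> topspace S. f x \<in> T}"
      using \<open>x \<in> topspace S\<close>
      by (intro exI[of _ "{y \<in> topspace S. f y \<in> ball (f x) d}"]) auto
  qed
  then show ?thesis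
    by (simp add: continuous_map)
qed

lemma Gamma0_imp_plots:
  assumes "c \<in> Gamma0 S C"
  shows "(\<lambda>x. c (x 0)) \<in> plots S C 1 (topspace (Euclidean_space 1))"
proof -
  have "continuous_map (Euclidean_space 1) S (\<lambda>x. c (x 0))"
    using assms by (intro continuous_map_comp_coordinate) (simp add: Gamma0_def)
  moreover have "smooth_on 1 (topspace (Euclidean_space 1)) (f \<circ> (\<lambda>x. c (x 0)))" if "f \<in> C" for f
    using assms that smooth_on_line_if_smooth_real[of "f \<circ> c"] by (simp add: Gamma0_def o_def)
  ultimately show ?thesis
    by (simp add: plots_def)
qed

theorem theorem4p3:
  fixes S :: "'a topology" and C :: "('a \<Rightarrow> real) set"
  assumes "differential_space S C"
    and "continuously_reflexive S C"
  shows "smith_differentiable_structure S C"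
proof -
  interpret differential_space S C by fact
  have "C \<subseteq> C0 S"
    using functions_on continuous_map_structure_function by (auto simp: C0_def)
  moreover have "f \<in> C"
    if "f \<in> C0 S"
      and smooth: "\<forall>n U. openin (Euclidean_space n) U \<longrightarrow>
        (\<forall>g\<in>plots S C n U. smooth_on n U (f \<circ> g))" for f
  proof -
    have "smooth_real (f \<circ> c)" if "c \<in> Gamma0 S C" for c
    proof -
      have "smooth_on 1 (topspace (Euclidean_space 1)) (f \<circ> (\<lambda>x. c (x 0)))"
        using smooth Gamma0_imp_plots[OF that] by blast
      from smooth_real_if_smooth_on_line[OF this] show ?thesis
        by (simp add: o_def)
    qed
    then have "f \<in> Phi0 S (Gamma0 S C)"
      using \<open>f \<in> C0 S\<close> by (simp add: Phi0_def)
    then show ?thesis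
      using assms(2) by (auto simp: continuously_reflexive_def)
  qed
  ultimately show ?thesis
    unfolding smith_differentiable_structure_def by blast
qed

end
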